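(* Let $b$ be a graph over $(X,m)$ with $m(X)<\infty$. For any $p\in[1,\infty)$ and any function $d:X\times X\to[0,\infty)$ with $\delta(d)>0$, we have $$\lambda^{(1)}_{p}\leq 2^{p-1}\,\frac{h^{(1)}(d)}{\delta(d)}.$$
   Context: Setting: $X$ is a countable (finite or infinite) set with at least two elements, and $C(X)$ is the space of real-valued functions on $X$. A graph $b$ over $(X,m)$ consists of a symmetric function $b:X\times X\to[0,\infty)$ with $b(x,x)=0$ and $\sum_{y\in X}b(x,y)<\infty$ for all $x\in X$, and a function $m:X\to(0,\infty)$, extended to a measure on subsets by $m(W)=\sum_{x\in W}m(x)$. $\ell^p(X,m)$ is the space of $f\in C(X)$ with $\|f\|_{m,p}=\bigl(\sum_{x\in X}|f(x)|^p m(x)\bigr)^{1/p}<\infty$. Energy: $\mathcal{E}_p(f)=\frac12\sum_{x,y\in X}b(x,y)|f(x)-f(y)|^p\in[0,\infty]$ for $f\in C(X)$, and (for $m(X)<\infty$) $$\lambda^{(1)}_p=\inf_{f\in\ell^p(X,m),\ f\text{ non-constant}}\ \frac{\mathcal{E}_p(f)}{\inf_{\gamma\in\mathbb{R}}\|f-\gamma\|_{m,p}^p}.$$ For $W\subseteq X$, $\partial W=W\times(X\setminus W)$, and for $d:X\times X\to[0,\infty)$, $|\partial W|_{bd}=\sum_{(x,y)\in\partial W}b(x,y)d(x,y)\in[0,\infty]$, $$h^{(1)}(d)=\inf_{\emptyset\ne W\subseteq X,\ m(W)\le m(X)/2}\frac{|\partial W|_{bd}}{m(W)},\qquad \delta(d)=\inf\{d(x,y):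 x,y\in X,\ b(x,y)>0\}.$$ Conventions: $\inf\emptyset=+\infty$ and $a/(+\infty)=0$ for $a\in[0,\infty)$ (relevant only if $b\equiv0$). *)

theory Defs
  imports "HOL-Analysis.Analysis"
begin

text \<open>
  The vertex set is a carrier \<open>X\<close> of an arbitrary type. All functions are constrained on \<open>X\<close> only, and
  every notion below depends only on their values there. Quantities ranging over \<open>[0,\<infinity>]\<close>
  live in \<^typ>\<open>ennreal\<close>, where every family is summable, \<open>Inf {} = top\<close> and \<open>a / top = 0\<close>.
\<close>

locale weighted_graph =
  fixes X :: "'a set" and b :: "'a \<Rightarrow> 'a \<Rightarrow> real" and m :: "'a \<Rightarrow> real"
  assumes countable_vertices: "countable X"
    and two_vertices: "\<exists>x\<in>X. \<exists>y\<in>X. x \<noteq> y"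
    and edge_nonneg: "x \<in> X \<Longrightarrow> y \<in> X \<Longrightarrow> 0 \<le> b x y"
    and edge_sym: "x \<in> X \<Longrightarrow> y \<in> X \<Longrightarrow> b x y = b y x"
    and edge_diag: "x \<in> X \<Longrightarrow> b x x = 0"
    and edge_summable: "x \<in> X \<Longrightarrow> (\<lambda>y. b x y) summable_on X"
    and mass_pos: "x \<in> X \<Longrightarrow> 0 < m x"

definition mass :: "('a \<Rightarrow> real) \<Rightarrow> 'a set \<Rightarrow> ennreal" where
  "mass m W = (\<Sum>\<^sub>\<infinity>x\<in>W. ennreal (m x))"

definition lp_space :: "'a set \<Rightarrow> ('a \<Rightarrow> real) \<Rightarrow> real \<Rightarrow> ('a \<Rightarrow> real) set" where
  "lp_space X m p = {f. (\<lambda>x. \<bar>f x\<bar> powr p * m x) summable_on X}"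

text \<open>The real-valued norm is meaningful only on \<^const>\<open>lp_space\<close>: a divergent sum gives 0.\<close>

definition lp_norm :: "'a set \<Rightarrow> ('a \<Rightarrow> real) \<Rightarrow> real \<Rightarrow> ('a \<Rightarrow> real) \<Rightarrow> real" where
  "lp_norm X m p f = (\<Sum>\<^sub>\<infinity>x\<in>X. \<bar>f x\<bar> powr p * m x) powr (1 / p)"

definition energy :: "'a set \<Rightarrow> ('a \<Rightarrow> 'a \<Rightarrow> real) \<Rightarrow> real \<Rightarrow> ('a \<Rightarrow> real) \<Rightarrow> ennreal" where
  "energy X b p f = 1 / 2 * (\<Sum>\<^sub>\<infinity>(x, y)\<in>X \<times> X. ennreal (b x y * \<bar>f x - f y\<bar> powr p))"

text \<open>
  Intended for \<open>mass m X < top\<close> and \<open>p \<ge> 1\<close>. Then \<open>f - \<gamma>\<close> belongs to \<^const>\<open>lp_space\<close> for every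
  \<open>\<gamma>\<close>, and the denominator is positive for non-constant \<open>f\<close>.
\<close>

definition lambda1 :: "'a set \<Rightarrow> ('a \<Rightarrow> 'a \<Rightarrow> real) \<Rightarrow> ('a \<Rightarrow> real) \<Rightarrow> real \<Rightarrow> ennreal" where
  "lambda1 X b m p =
    (INF f \<in> {f \<in> lp_space X m p. \<not> f constant_on X}.
      energy X b p f / ennreal (INF \<gamma>::real. lp_norm X m p (\<lambda>x. f x - \<gamma>) powr p))"

definition edge_boundary :: "'a set \<Rightarrow> 'a set \<Rightarrow> ('a \<times> 'a) set" where
  "edge_boundary X W = W \<times> (X - W)"

definition boundary_area ::
    "'a set \<Rightarrow> ('a \<Rightarrow> 'a \<Rightarrow> real) \<Rightarrow> ('a \<Rightarrow> 'a \<Rightarrow> real) \<Rightarrow> 'a set \<Rightarrow> ennreal" where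
  "boundary_area X b d W = (\<Sum>\<^sub>\<infinity>(x, y)\<in>edge_boundary X W. ennreal (b x y * d x y))"

definition cheeger1 ::
    "'a set \<Rightarrow> ('a \<Rightarrow> 'a \<Rightarrow> real) \<Rightarrow> ('a \<Rightarrow> real) \<Rightarrow> ('a \<Rightarrow> 'a \<Rightarrow> real) \<Rightarrow> ennreal" where
  "cheeger1 X b m d =
    (INF W \<in> {W. W \<noteq> {} \<and> W \<subseteq> X \<and> mass m W \<le> mass m X / 2}.
      boundary_area X b d W / mass m W)"

definition min_edge_dist ::
    "'a set \<Rightarrow> ('a \<Rightarrow> 'a \<Rightarrow> real) \<Rightarrow> ('a \<Rightarrow> 'a \<Rightarrow> real) \<Rightarrow> ennreal" where
  "min_edge_dist X b d = Inf {ennreal (d x y) | x y. x \<in> X \<and> y \<in> X \<and> 0 < b x y}"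

end

theory Submission
  imports Defs
begin

text \<open>
  Test the Rayleigh quotient with the indicator function of an admissible set \<open>W\<close>. Its energy is
  the total edge weight of the boundary, which is at most \<open>|\<partial>W|/\<delta>(d)\<close>. Since the complement
  of \<open>W\<close> is at least as heavy as \<open>W\<close>, subtracting \<open>\<gamma>\<close> leaves a norm of at least
  \<open>m(W) (|1 - \<gamma>|\<^sup>p + |\<gamma>|\<^sup>p)\<close>, and convexity bounds the bracket below by \<open>2\<^bsup>1-p\<^esup>\<close>.
\<close>

section \<open>Convexity of power functions\<close>

lemma powr_half_sum_le:
  fixes a c p :: real
  assumes "0 \<le> a" "0 \<le> c" "1 \<le> p"
  shows "((a + c) / 2) powr p \<le> (a powr p + c powr p) / 2"
proof -
  \<comment> \<open>This settles the cases where one argument is 0; convexity is invoked only for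
    two positive arguments.\<close>
  have half: "(t / 2) powr p \<le> t powr p / 2" if "0 \<le> t" for t :: real
  proof -
    have "(2::real) powr 1 \<le> 2 powr p"
      using assms by (intro powr_mono) auto
    then show ?thesis
      using that mult_left_mono[of 2 "2 powr p" "t powr p"]
      by (simp add: powr_divide divide_simps mult.commute)
  qed
  consider "a = 0" | "c = 0" | "0 < a" "0 < c"
    using assms by linarith
  then show ?thesis
  proof cases
    case 3
    then show ?thesis
      using convex_onD[OF powr_convex[OF assms(3)], of "1/2" a c]
      by (simp add: add_divide_distrib)
  qed (use half assms in auto)
qed

text \<open>Source of the constant in the theorem: midpoint convexity is combined with
  \<open>\<bar>1 - \<gamma>\<bar> + \<bar>\<gamma>\<bar> \<ge> 1\<close>. Equality holds at
  \<open>\<gamma> = 1/2\<close>.\<close>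

lemma two_powr_le_sum_powr:
  fixes \<gamma> p :: real
  assumes "1 \<le> p"
  shows "2 powr (1 - p) \<le> \<bar>1 - \<gamma>\<bar> powr p + \<bar>\<gamma>\<bar> powr p"
proof -
  have "(1 / 2) powr p \<le> ((\<bar>1 - \<gamma>\<bar> + \<bar>\<gamma>\<bar>) / 2) powr p"
    using assms by (intro powr_mono2) auto
  also have "\<dots> \<le> (\<bar>1 - \<gamma>\<bar> powr p + \<bar>\<gamma>\<bar> powr p) / 2"
    using assms by (intro powr_half_sum_le) auto
  finally show ?thesis
    by (simp add: powr_diff powr_divide field_simps)
qed

section \<open>Passing between real and extended nonnegative sums\<close>

lemma infsum_cmult_ennreal:
  fixes c :: ennreal
  shows "(\<Sum>\<^sub>\<infinity>x\<in>A. c * f x) = c * (\<Sum>\<^sub>\<infinity>x\<in>A. f x)"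
  by (simp add: nonneg_infsum_complete SUP_mult_left_ennreal flip: sum_distrib_left)

lemma infsum_ennreal_eq:
  assumes "\<And>x. x \<in> A \<Longrightarrow> 0 \<le> f x" and "f summable_on A"
  shows "(\<Sum>\<^sub>\<infinity>x\<in>A. ennreal (f x)) = ennreal (infsum f A)"
proof -
  have "infsum (ennreal \<circ> f) A = ennreal (infsum f A)"
    using assms by (intro infsum_comm_additive_general)
      (auto intro!: sum_ennreal tendsto_ennrealI simp: isCont_def)
  then show ?thesis
    by (simp add: o_def)
qed

text \<open>The finite value of the extended sum bounds every finite partial sum. This turns the
  hypothesis \<open>mass m X < top\<close> into real summability of \<open>m\<close>.\<close>

lemma summable_on_if_infsum_ennreal_finite:
  assumes "\<And>x. x \<in> A \<Longrightarrow> 0 \<le> f x" and "(\<Sum>\<^sub>\<infinity>x\<in>A. ennreal (f x)) < top"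
  shows "f summable_on A"
proof (rule nonneg_bdd_above_summable_on)
  let ?S = "\<Sum>\<^sub>\<infinity>x\<in>A. ennreal (f x)"
  show "bdd_above (sum f ` {F. F \<subseteq> A \<and> finite F})"
  proof (rule bdd_aboveI2)
    fix F assume F: "F \<in> {F. F \<subseteq> A \<and> finite F}"
    have "ennreal (sum f F) = (\<Sum>x\<in>F. ennreal (f x))"
      using F assms(1) by (subst sum_ennreal) auto
    also have "\<dots> \<le> ?S"
      unfolding nonneg_infsum_complete[of A "\<lambda>x. ennreal (f x)", simplified]
      using F by (intro SUP_upper) auto
    finally show "sum f F \<le> enn2real ?S"
      using assms(2) by (metis ennreal_enn2real ennreal_le_iff enn2real_nonneg)
  qed
qed (use assms in auto)

section \<open>Energy, eigenvalue and boundary estimates on the graph\<close>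

context weighted_graph
begin

text \<open>Only pairs with exactly one endpoint in \<open>W\<close> contribute, each with
  difference of modulus 1. Symmetry of \<open>b\<close> makes the two orientations contribute
  equally, which cancels the factor 1/2.\<close>

lemma energy_indicator:
  assumes "W \<subseteq> X" and "1 \<le> p"
  shows "energy X b p (indicator W) = (\<Sum>\<^sub>\<infinity>(x, y)\<in>edge_boundary X W. ennreal (b x y))"
    (is "_ = ?B")
proof -
  let ?g = "\<lambda>(x, y). ennreal (b x y * \<bar>indicator W x - indicator W y\<bar> powr p)"
  let ?h = "\<lambda>(x, y). ennreal (b x y)"
  have "infsum ?g (X \<times> X) = infsum ?h (W \<times> (X - W) \<union> (X - W) \<times> W)"
    using assms by (intro infsum_cong_neutral) (auto simp: indicator_def of_bool_def split: if_splits)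
  also have "\<dots> = infsum ?h (W \<times> (X - W)) + infsum ?h ((X - W) \<times> W)"
    by (rule infsum_Un_disjoint) (auto intro: nonneg_summable_on_complete)
  also have "infsum ?h ((X - W) \<times> W) = (\<Sum>\<^sub>\<infinity>z\<in>W \<times> (X - W). ?h (prod.swap z))"
    by (rule infsum_reindex_bij_betw[symmetric]) (auto simp: bij_betw_def inj_on_def)
  also have "\<dots> = infsum ?h (W \<times> (X - W))"
    using assms by (intro infsum_cong) (auto simp: edge_sym subset_iff)
  finally have "energy X b p (indicator W) = 1 / 2 * (?B + ?B)"
    by (simp add: energy_def edge_boundary_def)
  also have "\<dots> = (1 / 2 * 2) * ?B"
    by (simp add: mult.assoc flip: mult_2)
  also have "1 / 2 * 2 = (1 :: ennreal)"
    by (simp add: ennreal_divide_times)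
  finally show ?thesis by simp
qed

text \<open>Carries out the whole test-function argument without \<open>d\<close>, which enters only
  when boundary weight is compared with boundary area.\<close>

lemma lambda1_le_boundary_weight:
  assumes fin: "mass m X < top" and p: "1 \<le> p"
    and W: "W \<noteq> {}" "W \<subseteq> X" "mass m W \<le> mass m X / 2"
  shows "lambda1 X b m p \<le> ennreal (2 powr (p - 1)) *
    ((\<Sum>\<^sub>\<infinity>(x, y)\<in>edge_boundary X W. ennreal (b x y)) / mass m W)"
    (is "_ \<le> _ * (?B / _)")
proof -
  have nn: "0 \<le> m x" if "x \<in> X" for x
    using mass_pos[OF that] by simp
  have sX: "m summable_on X"
    using fin nn by (auto simp: mass_def intro: summable_on_if_infsum_ennreal_finite)
  have sum: "m summable_on V" and mass_eq: "mass m V = ennreal (infsum m V)" if "V \<subseteq> X" for V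
    using summable_on_subset_banach[OF sX that] nn that
    by (auto simp: mass_def intro!: infsum_ennreal_eq)
  define M N where "M = infsum m W" and "N = infsum m (X - W)"
  have split: "infsum m X = M + N"
    unfolding M_def N_def using sum W infsum_Un_disjoint[of m W "X - W"]
    by (simp add: Un_absorb1)
  have "0 \<le> N"
    unfolding N_def using nn by (intro infsum_nonneg) auto
  have Mpos: "0 < M"
  proof -
    obtain w where w: "w \<in> W" using W by auto
    have "infsum m {w} \<le> M"
      unfolding M_def using sum W w nn by (intro infsum_mono2) auto
    then show ?thesis
      using mass_pos[of w] w W by auto
  qed
  have "ennreal M \<le> ennreal ((M + N) / 2)"
    using W mass_eq[of W] mass_eq[of X] split \<open>0 \<le> N\<close> Mpos
    by (simp add: M_def[symmetric] ennreal_divide_numeral del: ennreal_plus)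
  then have MN: "M \<le> N"
    using \<open>0 \<le> N\<close> Mpos by (simp add: ennreal_le_iff)
  \<comment> \<open>An empty complement would give \<open>N = 0\<close>, against
    \<open>0 < M \<le> N\<close>. A point outside \<open>W\<close> is what makes the indicator
    non-constant.\<close>
  have "X - W \<noteq> {}"
    using MN Mpos by (metis N_def infsum_empty not_le)
  let ?f = "indicator W :: 'a \<Rightarrow> real"
  have nonconst: "\<not> ?f constant_on X"
    proof -
    obtain x y where "x \<in> W" "x \<in> X" "y \<in> X" "y \<notin> W"
      using W \<open>X - W \<noteq> {}\<close> by blast
    then have "?f x \<noteq> ?f y" by simp
    with \<open>x \<in> X\<close> \<open>y \<in> X\<close> show ?thesis
      unfolding constant_on_def by metis
  qed
  have lp: "?f \<in> lp_space X m p"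
  proof -
    have "(\<lambda>x. \<bar>?f x\<bar> powr p * m x) summable_on X \<longleftrightarrow> m summable_on W"
      using W by (intro summable_on_cong_neutral) auto
    then show ?thesis using sum W by (simp add: lp_space_def)
  qed
  \<comment> \<open>The shifted indicator takes only the values \<open>1 - \<gamma>\<close> on
    \<open>W\<close> and \<open>- \<gamma>\<close> on the complement. The exponents
    \<open>1 / p\<close> and \<open>p\<close> cancel because the sum is nonnegative.\<close>
  have norm: "lp_norm X m p (\<lambda>x. ?f x - \<gamma>) powr p = \<bar>1 - \<gamma>\<bar> powr p * M + \<bar>\<gamma>\<bar> powr p * N" for \<gamma>
  proof -
    let ?g = "\<lambda>x. \<bar>?f x - \<gamma>\<bar> powr p * m x"
    have 1: "(?g has_sum \<bar>1 - \<gamma>\<bar> powr p * M) W"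
      unfolding M_def using has_sum_cmult_right[OF has_sum_infsum[OF sum[OF W(2)]], of "\<bar>1 - \<gamma>\<bar> powr p"]
      by (rule has_sum_cong[THEN iffD1, rotated]) auto
    have 2: "(?g has_sum \<bar>\<gamma>\<bar> powr p * N) (X - W)"
      unfolding N_def using has_sum_cmult_right[OF has_sum_infsum[OF sum[OF Diff_subset]], of "\<bar>\<gamma>\<bar> powr p"]
      by (rule has_sum_cong[THEN iffD1, rotated]) auto
    have "infsum ?g X = \<bar>1 - \<gamma>\<bar> powr p * M + \<bar>\<gamma>\<bar> powr p * N"
      using infsumI[OF has_sum_Un_disjoint[OF 1 2]] W by (simp add: Un_absorb1)
    moreover have "0 \<le> infsum ?g X"
      using nn by (intro infsum_nonneg) auto
    ultimately show ?thesis
      using p by (simp add: lp_norm_def powr_powr)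
  qed
  define D where "D = (INF \<gamma>::real. lp_norm X m p (\<lambda>x. ?f x - \<gamma>) powr p)"
  \<comment> \<open>The bound is uniform in \<open>\<gamma>\<close>: \<open>M \<le> N\<close> allows
    \<open>N\<close> to be lowered to \<open>M\<close>, and then the convexity estimate
    applies.\<close>
  have "2 powr (1 - p) * M \<le> D"
    unfolding D_def
  proof (rule cINF_greatest)
    fix \<gamma> :: real
    have "2 powr (1 - p) * M \<le> (\<bar>1 - \<gamma>\<bar> powr p + \<bar>\<gamma>\<bar> powr p) * M"
      using two_powr_le_sum_powr[OF p] Mpos by (intro mult_right_mono) auto
    also have "\<dots> \<le> \<bar>1 - \<gamma>\<bar> powr p * M + \<bar>\<gamma>\<bar> powr p * N"
      using MN by (simp add: distrib_right mult_left_mono)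
    finally show "2 powr (1 - p) * M \<le> lp_norm X m p (\<lambda>x. ?f x - \<gamma>) powr p"
      by (simp add: norm)
  qed simp
  moreover have "0 < 2 powr (1 - p) * M"
    using Mpos by simp
  \<comment> \<open>Positivity of \<open>D\<close> matters for the quotient:
    \<open>inverse (ennreal D)\<close> would be \<open>top\<close> at \<open>D = 0\<close>, whereas
    here it is the real inverse.\<close>
  ultimately have inv: "inverse D \<le> inverse (2 powr (1 - p) * M)" and Dpos: "0 < D"
    by (blast intro: le_imp_inverse_le less_le_trans)+
  have "lambda1 X b m p \<le> energy X b p ?f / ennreal D"
    unfolding lambda1_def D_def using lp nonconst by (intro INF_lower) auto
  also have "\<dots> = ?B * ennreal (inverse D)"
    using Dpos energy_indicator[OF W(2) p] by (simp add: divide_ennreal_def inverse_ennreal)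
  also have "\<dots> \<le> ?B * ennreal (inverse (2 powr (1 - p) * M))"
    using inv by (intro mult_left_mono ennreal_leI) auto
  also have "inverse (2 powr (1 - p) * M) = 2 powr (p - 1) * inverse M"
    by (simp flip: powr_minus)
  also have "?B * ennreal (2 powr (p - 1) * inverse M) = ennreal (2 powr (p - 1)) * (?B / mass m W)"
    using Mpos mass_eq[OF W(2)]
    by (simp add: M_def[symmetric] ennreal_mult divide_ennreal_def inverse_ennreal ac_simps)
  finally show ?thesis .
qed

text \<open>Covers the degenerate case of an infinite \<open>\<delta>\<close>. The indicator of a
  single vertex has finite support and zero energy, and 0 divided by any extended number is 0, so
  the denominator need not be computed.\<close>

lemma lambda1_eq_0_if_no_edges:
  assumes no_edges: "\<And>x y. x \<in> X \<Longrightarrow> y \<in> X \<Longrightarrow> b x y = 0"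
  shows "lambda1 X b m p = 0"
proof -
  obtain x y where xy: "x \<in> X" "y \<in> X" "x \<noteq> y"
    using two_vertices by blast
  let ?f = "indicator {x} :: 'a \<Rightarrow> real"
  have "(\<lambda>z. \<bar>?f z\<bar> powr p * m z) summable_on X \<longleftrightarrow> m summable_on {x}"
    using xy by (intro summable_on_cong_neutral) auto
  then have "?f \<in> lp_space X m p"
    by (simp add: lp_space_def)
  moreover have "\<not> ?f constant_on X"
  proof -
    have "?f x \<noteq> ?f y" using xy by simp
    with xy show ?thesis
      unfolding constant_on_def by metis
  qed
  moreover have "energy X b p ?f = 0"
    using no_edges by (auto simp: energy_def intro!: infsum_0)
  ultimately have "lambda1 X b m p \<le> 0 / ennreal (INF \<gamma>::real. lp_norm X m p (\<lambda>x. ?f x - \<gamma>) powr p)"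
    unfolding lambda1_def by (intro INF_lower2[of ?f]) auto
  then show ?thesis by simp
qed

text \<open>Holds term by term: either the edge weight vanishes, or the pair competes in the infimum
  defining \<open>min_edge_dist\<close>. The product form stays valid when that infimum is 0 or
  \<open>top\<close>.\<close>

lemma min_edge_dist_mult_boundary_weight_le:
  assumes "W \<subseteq> X"
  shows "min_edge_dist X b d * (\<Sum>\<^sub>\<infinity>(x, y)\<in>edge_boundary X W. ennreal (b x y)) \<le> boundary_area X b d W"
  unfolding boundary_area_def infsum_cmult_ennreal[symmetric]
proof (rule infsum_mono)
  fix z assume "z \<in> edge_boundary X W"
  then obtain x y where z: "z = (x, y)" "x \<in> X" "y \<in> X"
    using assms by (auto simp: edge_boundary_def)
  have "min_edge_dist X b d * ennreal (b x y) \<le> ennreal (b x y * d x y)"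
  proof (cases "b x y = 0")
    case False
    then have pos: "0 < b x y"
      using edge_nonneg[of x y] z by simp
    then have "min_edge_dist X b d \<le> ennreal (d x y)"
      unfolding min_edge_dist_def using z by (intro Inf_lower) auto
    then show ?thesis
      using pos mult_right_mono[of "min_edge_dist X b d" "ennreal (d x y)" "ennreal (b x y)"]
      by (simp add: ennreal_mult' mult.commute)
  qed simp
  then show "min_edge_dist X b d * (case z of (x, y) \<Rightarrow> ennreal (b x y))
      \<le> (case z of (x, y) \<Rightarrow> ennreal (b x y * d x y))"
    using z by simp
qed (auto intro: nonneg_summable_on_complete)

end

theorem theorem3p10:
  fixes X :: "'a set" and b :: "'a \<Rightarrow> 'a \<Rightarrow> real" and m :: "'a \<Rightarrow> real"
    and p :: real and d :: "'a \<Rightarrow> 'a \<Rightarrow> real"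
  assumes "weighted_graph X b m"
    and "mass m X < top"
    and "1 \<le> p"
    and "\<And>x y. x \<in> X \<Longrightarrow> y \<in> X \<Longrightarrow> 0 \<le> d x y"
    and "0 < min_edge_dist X b d"
  shows "lambda1 X b m p \<le> ennreal (2 powr (p - 1)) * (cheeger1 X b m d / min_edge_dist X b d)"
proof -
  interpret weighted_graph X b m by fact
  define \<delta> where "\<delta> = min_edge_dist X b d"
  define c where "c = ennreal (2 powr (p - 1))"
  have c: "0 < c" "c < top"
    by (auto simp: c_def)
  show ?thesis
  proof (cases "\<delta> = top")
    case True
    \<comment> \<open>A single edge of positive weight would bound \<open>\<delta>\<close> by the
      finite number \<open>d x y\<close>.\<close>
    have "b x y = 0" if "x \<in> X" "y \<in> X" for x y
    proof (rule ccontr)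
      assume "b x y \<noteq> 0"
      then have "0 < b x y"
        using that edge_nonneg[of x y] by simp
      then have "\<delta> \<le> ennreal (d x y)"
        unfolding \<delta>_def min_edge_dist_def using that by (intro Inf_lower) auto
      then show False
        using True by (simp add: top_unique)
    qed
    then show ?thesis
      using lambda1_eq_0_if_no_edges by simp
  next
    case False
    then have \<delta>: "0 < \<delta>" "\<delta> < top"
      using assms by (auto simp: \<delta>_def top.not_eq_extremum)
    \<comment> \<open>With the constants moved to the left, the right side is a bare infimum, so it
      suffices to treat each admissible \<open>W\<close> separately.\<close>
    have "lambda1 X b m p * \<delta> / c \<le> cheeger1 X b m d"
      unfolding cheeger1_def
    proof (rule INF_greatest)
      fix W assume "W \<in> {W. W \<noteq> {} \<and> W \<subseteq> X \<and> mass m W \<le> mass m X / 2}"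
      then have W: "W \<noteq> {}" "W \<subseteq> X" "mass m W \<le> mass m X / 2" by auto
      define B where "B = (\<Sum>\<^sub>\<infinity>(x, y)\<in>edge_boundary X W. ennreal (b x y))"
      have "lambda1 X b m p * \<delta> / c \<le> c * (B / mass m W) * \<delta> / c"
        using lambda1_le_boundary_weight[OF assms(2,3) W]
        by (intro divide_right_mono_ennreal mult_right_mono) (auto simp: c_def B_def)
      also have "\<dots> = (\<delta> * B / mass m W) * c / c"
        by (simp add: divide_ennreal_def ac_simps)
      also have "\<dots> = \<delta> * B / mass m W"
        using c by (intro ennreal_mult_divide_eq) auto
      also have "\<dots> \<le> boundary_area X b d W / mass m W"
        unfolding B_def \<delta>_def using W
        by (intro divide_right_mono_ennreal min_edge_dist_mult_boundary_weight_le)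
      finally show "lambda1 X b m p * \<delta> / c \<le> boundary_area X b d W / mass m W" .
    qed
    \<comment> \<open>The constants are moved back; cancelling them is legitimate because
      \<open>c\<close> and \<open>\<delta>\<close> are both positive and finite.\<close>
    then have "c * (lambda1 X b m p * \<delta> / c / \<delta>) \<le> c * (cheeger1 X b m d / \<delta>)"
      by (intro divide_right_mono_ennreal mult_left_mono) auto
    moreover have "c * (lambda1 X b m p * \<delta> / c / \<delta>) = lambda1 X b m p * \<delta> / \<delta> * c / c"
      by (simp add: divide_ennreal_def ac_simps)
    moreover have "\<dots> = lambda1 X b m p"
      using c \<delta> by (simp add: ennreal_mult_divide_eq)
    ultimately show ?thesis
      by (simp add: c_def \<delta>_def)
  qed
qed

end
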